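(* The $k$-deck of an unknown binary string $x\in\{0,1\}^n$ can be determined exactly, with high probability, from $\exp(O(k\log n))$ traces of $x$ from the symmetric deletion channel with deletion probability $p\le 1-k/n$.
   Context: The $k$-deck of a string is the multiset of all its length-$k$ subsequences (one for each $k$-subset of positions). The symmetric deletion channel with deletion probability $p$ deletes each coordinate independently with probability $p$ and outputs the subsequence of surviving coordinates; each output is a trace. "With high probability" means with probability at least $1-o(1)$ as $n\to\infty$. *)

theory Defs
  imports "HOL-Probability.Probability" "HOL-Library.Multiset"
begin

definition deck :: "nat \<Rightarrow> 'a list \<Rightarrow> 'a list multiset" where
  "deck k x = image_mset (nths x) (mset_set {S. S \<subseteq> {..<length x} \<and> card S = k})"

text \<open>Here \<open>s i\<close> says that coordinate \<open>i\<close> survives, which happens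
  independently with probability \<open>1 - p\<close>. Meaningful for \<open>p\<close> between 0 and 1 only, since
  \<^const>\<open>bernoulli_pmf\<close> truncates its parameter.\<close>

definition deletion_channel :: "real \<Rightarrow> 'a list \<Rightarrow> 'a list pmf" where
  "deletion_channel p x =
     map_pmf (\<lambda>s. nths x {i. s i}) (Pi_pmf {..<length x} False (\<lambda>_. bernoulli_pmf (1 - p)))"

definition traces :: "nat \<Rightarrow> real \<Rightarrow> 'a list \<Rightarrow> 'a list list pmf" where
  "traces m p x = replicate_pmf m (deletion_channel p x)"

end

theory Submission
  imports Defs
begin

text \<open>
  Let \<open>S w\<close> be the number of occurrences of \<open>w\<close> in the \<open>k\<close>-decks of all \<open>m\<close> traces and \<open>N\<close> the
  total size of these decks. A \<open>k\<close>-subset of positions survives with probability \<open>(1 - p)^k\<close>, so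
  \<open>S w\<close> and \<open>N\<close> have means \<open>m (1 - p)^k c\<close> and \<open>m (1 - p)^k (n choose k)\<close>, where \<open>c\<close> is the
  multiplicity of \<open>w\<close> in the deck of \<open>x\<close>. The unknown \<open>p\<close> cancels in \<open>(n choose k) S w / N\<close>, and
  rounding this ratio gives \<open>c\<close> once every \<open>S w\<close>, as well as \<open>N\<close>, is within \<open>m (1 - p)^k / 8\<close> of its mean.
  As \<open>1 - p \<ge> k / n \<ge> 1 / n\<close>, Chebyshev's inequality and a union bound over the \<open>2^k + 1\<close> events
  show that \<open>m = n^(6k)\<close> traces suffice.
\<close>

section \<open>Decks of strings and of their subsequences\<close>

lemma size_filter_deck:
  "size (filter_mset P (deck k x)) = card {S. S \<subseteq> {..<length x} \<and> card S = k \<and> P (nths x S)}"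
  unfolding deck_def filter_mset_image_mset
  by (simp add: conj_assoc)

lemma size_deck: "size (deck k x) = length x choose k"
  unfolding deck_def by (simp add: n_subsets)

lemma deck_0: "deck 0 x = {#[]#}"
proof -
  have "{S. S \<subseteq> {..<length x} \<and> card S = 0} = {{}}"
    using finite_subset by fastforce
  then show ?thesis
    by (simp add: deck_def)
qed

text \<open>Renumbering the kept positions in increasing order matches the \<open>k\<close>-subsets
  of positions of \<open>nths x A\<close> with the \<open>k\<close>-subsets of \<open>A\<close>
  inside \<open>x\<close>, and matched subsets select the same word. Decks of traces can thus be
  counted over position sets of \<open>x\<close> itself.\<close>

lemma deck_nths:
  "deck k (nths x A) = image_mset (nths x) (mset_set {S. S \<subseteq> A \<inter> {..<length x} \<and> card S = k})"
proof -
  define A' where "A' = A \<inter> {..<length x}"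
  \<comment> \<open>\<open>rank i\<close> is the index that position \<open>i\<close> of
    \<open>x\<close> receives in \<open>nths x A\<close>, and \<open>h\<close> pulls index sets back
    to positions of \<open>x\<close>; \<open>nths_nths\<close> composes selections in this
    form.\<close>
  define rank where "rank i = card {j \<in> A'. j < i}" for i
  define h where "h B = {i \<in> A'. rank i \<in> B}" for B
  have fin: "finite A'"
    by (simp add: A'_def)
  have less: "rank i < rank j" if "i \<in> A'" "i < j" for i j
    unfolding rank_def using that fin by (intro psubset_card_mono) auto
  have inj: "inj_on rank A'"
    by (rule linorder_inj_onI') (use less in force)
  have "rank ` A' \<subseteq> {..<card A'}"
    unfolding rank_def using fin by (auto intro!: psubset_card_mono)
  then have img: "rank ` A' = {..<card A'}"
    using inj by (intro card_subset_eq) (auto simp: card_image)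
  have len: "length (nths x A) = card A'"
    unfolding length_nths A'_def by (rule arg_cong[of _ _ card]) auto
  have nths_h: "nths (nths x A) B = nths x (h B)" for B
  proof -
    \<comment> \<open>Indices beyond the end of \<open>x\<close> select nothing, so \<open>A\<close>
      may be cut down to the finite set \<open>A'\<close> in which \<open>rank\<close>
      counts.\<close>
    have "nths x A = nths x A'"
      unfolding A'_def nths_def by (intro arg_cong[of _ _ "map fst"] filter_cong)
        (auto dest: set_zip_rightD)
    then show ?thesis
      by (simp add: nths_nths h_def rank_def)
  qed
  have img_h: "rank ` h B = B" if "B \<subseteq> {..<card A'}" for B
  proof -
    have "rank ` h B = rank ` A' \<inter> B"
      unfolding h_def by auto
    then show ?thesis
      using that img by auto
  qed
  have inj_h: "inj_on rank (h B)" for B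
    using inj by (rule inj_on_subset) (auto simp: h_def)
  have h_img: "h (rank ` S) = S" if "S \<subseteq> A'" for S
    using that inj unfolding h_def by (auto dest: inj_onD)
  have bij: "bij_betw h {B. B \<subseteq> {..<card A'} \<and> card B = k} {S. S \<subseteq> A' \<and> card S = k}"
  proof (rule bij_betw_byWitness[where f' = "image rank"])
    show "h ` {B. B \<subseteq> {..<card A'} \<and> card B = k} \<subseteq> {S. S \<subseteq> A' \<and> card S = k}"
    proof clarify
      fix B assume "B \<subseteq> {..<card A'}" "k = card B"
      then show "h B \<subseteq> A' \<and> card (h B) = card B"
        using card_image[OF inj_h[of B]] img_h[of B] by (auto simp: h_def)
    qed
    show "(`) rank ` {S. S \<subseteq> A' \<and> card S = k} \<subseteq> {B. B \<subseteq> {..<card A'} \<and> card B = k}"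
      using img by (auto intro!: card_image inj_on_subset[OF inj])
  qed (auto simp: img_h h_img)
  have "deck k (nths x A) = image_mset (nths x) (image_mset h (mset_set {B. B \<subseteq> {..<card A'} \<and> card B = k}))"
    unfolding deck_def len by (simp add: multiset.map_comp comp_def flip: nths_h)
  also have "image_mset h (mset_set {B. B \<subseteq> {..<card A'} \<and> card B = k}) = mset_set {S. S \<subseteq> A' \<and> card S = k}"
    using bij by (simp add: image_mset_mset_set bij_betw_def)
  finally show ?thesis
    by (simp add: A'_def)
qed

section \<open>Expected deck counts of one trace\<close>

lemma prob_subset_survives:
  fixes n :: nat
  assumes "S \<subseteq> {..<n}" "0 \<le> q" "q \<le> 1"
  shows "measure_pmf.prob (Pi_pmf {..<n} False (\<lambda>_. bernoulli_pmf q)) {s. S \<subseteq> {i. s i}} = q ^ card S"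
proof -
  \<comment> \<open>As a box with one constraint per coordinate, the event has a product
    probability, with factor \<open>q\<close> inside \<open>S\<close> and 1 outside.\<close>
  have "{s. S \<subseteq> {i. s i}} = Pi {..<n} (\<lambda>i. if i \<in> S then {True} else UNIV)"
    using assms(1) by (auto simp: Pi_def split: if_splits)
  then have "measure_pmf.prob (Pi_pmf {..<n} False (\<lambda>_. bernoulli_pmf q)) {s. S \<subseteq> {i. s i}}
      = (\<Prod>i<n. if i \<in> S then q else 1)"
    using assms(2,3) by (auto simp: measure_Pi_pmf_Pi measure_pmf_single intro!: prod.cong)
  also have "\<dots> = (\<Prod>i\<in>S. q)"
    using assms(1) by (simp add: prod.inter_restrict[symmetric] Int_absorb1)
  finally show ?thesis
    by simp
qed

lemma finite_deletion_channel: "finite (set_pmf (deletion_channel p x))"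
  unfolding deletion_channel_def
  by (auto intro!: finite_imageI finite_subset[OF set_Pi_pmf_subset'] finite_PiE_dflt)

text \<open>Linearity of expectation: by \<open>deck_nths\<close> the count is a sum, over the
  subsets \<open>S\<close> counted in \<open>x\<close>, of indicators that \<open>S\<close>
  survives. The predicate \<open>P\<close> lets one proof serve both single words and the total
  size.\<close>

lemma expectation_filter_deck:
  assumes "0 \<le> p" "p \<le> 1"
  shows "measure_pmf.expectation (deletion_channel p x) (\<lambda>t. real (size (filter_mset P (deck k t))))
    = (1 - p) ^ k * real (size (filter_mset P (deck k x)))"
proof -
  let ?M = "Pi_pmf {..<length x} False (\<lambda>_. bernoulli_pmf (1 - p))"
  define \<S> where "\<S> = {S. S \<subseteq> {..<length x} \<and> card S = k \<and> P (nths x S)}"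
  have fin: "finite \<S>"
    unfolding \<S>_def by (rule finite_subset[of _ "Pow {..<length x}"]) auto
  have eq: "real (size (filter_mset P (deck k (nths x {i. s i})))) = (\<Sum>S\<in>\<S>. indicator {s. S \<subseteq> {i. s i}} s)" for s
  proof -
    have "size (filter_mset P (deck k (nths x {i. s i}))) = card {S \<in> \<S>. S \<subseteq> {i. s i}}"
      unfolding deck_nths filter_mset_image_mset \<S>_def
      by simp (rule arg_cong[of _ _ card]; auto)
    also have "real \<dots> = (\<Sum>S\<in>\<S>. indicator {s. S \<subseteq> {i. s i}} s)"
      using fin by (simp add: indicator_def sum.If_cases Int_def)
    finally show ?thesis .
  qed
  have "measure_pmf.expectation (deletion_channel p x) (\<lambda>t. real (size (filter_mset P (deck k t))))
    = (\<Sum>S\<in>\<S>. measure_pmf.prob ?M {s. S \<subseteq> {i. s i}})"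
    unfolding deletion_channel_def integral_map_pmf eq
    by (subst Bochner_Integration.integral_sum)
      (auto simp: measure_pmf.emeasure_eq_measure intro!: integrable_real_indicator)
  also have "\<dots> = (\<Sum>S\<in>\<S>. (1 - p) ^ k)"
    using assms by (intro sum.cong) (auto simp: \<S>_def prob_subset_survives)
  finally show ?thesis
    by (simp add: size_filter_deck \<S>_def mult.commute)
qed

section \<open>Second moments and Chebyshev's inequality for independent samples\<close>

lemma expectation_bind_pmf_finite:
  fixes h :: "'b \<Rightarrow> real"
  assumes "finite (set_pmf p)" "\<And>x. x \<in> set_pmf p \<Longrightarrow> finite (set_pmf (f x))"
  shows "measure_pmf.expectation (p \<bind> f) h
    = measure_pmf.expectation p (\<lambda>x. measure_pmf.expectation (f x) h)"
  using assms
  by (simp add: pmf_expectation_bind[of "set_pmf p"] integral_measure_pmf[of "set_pmf p"])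

lemma finite_replicate_pmf: "finite (set_pmf p) \<Longrightarrow> finite (set_pmf (replicate_pmf m p))"
  by (induction m) auto

text \<open>One induction proves both claims: when the square of a sum is expanded at a new draw,
  the cross term vanishes because the draws are independent and centred.\<close>

lemma
  fixes g :: "'a \<Rightarrow> real"
  assumes fin: "finite (set_pmf p)" and zero: "measure_pmf.expectation p g = 0"
  shows expectation_sum_list_centred:
      "measure_pmf.expectation (replicate_pmf m p) (\<lambda>xs. \<Sum>x\<leftarrow>xs. g x) = 0"
    and variance_sum_list_centred:
      "measure_pmf.expectation (replicate_pmf m p) (\<lambda>xs. (\<Sum>x\<leftarrow>xs. g x)\<^sup>2)
        = real m * measure_pmf.expectation p (\<lambda>x. (g x)\<^sup>2)"
proof (induction m)
  case (Suc m)
  note [simp] = fin finite_replicate_pmf integrable_measure_pmf_finite expectation_bind_pmf_finite zero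
  case 1
  show ?case
    using Suc by simp
  case 2
  show ?case
    using Suc by (simp add: power2_sum algebra_simps)
qed simp_all

lemma replicate_pmf_deviation:
  fixes f :: "'a \<Rightarrow> real"
  assumes fin: "finite (set_pmf p)" and m: "m > 0" and d: "d > 0"
    and bound: "\<And>x. x \<in> set_pmf p \<Longrightarrow> \<bar>f x\<bar> \<le> B"
  defines "\<mu> \<equiv> measure_pmf.expectation p f"
  shows "measure_pmf.prob (replicate_pmf m p) {xs. \<bar>(\<Sum>x\<leftarrow>xs. f x) - real m * \<mu>\<bar> \<ge> real m * d}
    \<le> B\<^sup>2 / (real m * d\<^sup>2)"
proof -
  define g where "g = (\<lambda>x. f x - \<mu>)"
  note [simp] = fin finite_replicate_pmf integrable_measure_pmf_finite
  have zero: "measure_pmf.expectation p g = 0"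
    by (simp add: g_def \<mu>_def)
  have "measure_pmf.expectation p (\<lambda>x. (g x)\<^sup>2) = measure_pmf.expectation p (\<lambda>x. (f x)\<^sup>2) - \<mu>\<^sup>2"
    by (simp add: g_def power2_eq_square algebra_simps flip: \<mu>_def)
  also have "\<dots> \<le> measure_pmf.expectation p (\<lambda>x. (f x)\<^sup>2)"
    by simp
  also have "\<dots> \<le> measure_pmf.expectation p (\<lambda>x. B\<^sup>2)"
    by (intro integral_mono_AE) (auto simp: AE_measure_pmf_iff abs_le_square_iff[symmetric] intro: order_trans[OF bound abs_ge_self])
  finally have var: "measure_pmf.expectation p (\<lambda>x. (g x)\<^sup>2) \<le> B\<^sup>2"
    by simp
  have "measure_pmf.prob (replicate_pmf m p) {xs. \<bar>\<Sum>x\<leftarrow>xs. g x\<bar> \<ge> real m * d}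
      \<le> measure_pmf.expectation (replicate_pmf m p) (\<lambda>xs. (\<Sum>x\<leftarrow>xs. g x)\<^sup>2) / (real m * d)\<^sup>2"
    using measure_pmf.second_moment_method[of "\<lambda>xs. \<Sum>x\<leftarrow>xs. g x" "replicate_pmf m p" "real m * d"] m d
    by simp
  also have "\<dots> \<le> real m * B\<^sup>2 / (real m * d)\<^sup>2"
    unfolding variance_sum_list_centred[OF fin zero]
    using var by (intro divide_right_mono mult_left_mono) auto
  also have "\<dots> = B\<^sup>2 / (real m * d\<^sup>2)"
    using m by (simp add: power2_eq_square)
  \<comment> \<open>The events need agree only on the support, whose lists have length
    \<open>m\<close>, so that centring every entry subtracts \<open>real m * \<mu>\<close> in
    total.\<close>
  also have "{xs. \<bar>\<Sum>x\<leftarrow>xs. g x\<bar> \<ge> real m * d} \<inter> set_pmf (replicate_pmf m p)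
    = {xs. \<bar>(\<Sum>x\<leftarrow>xs. f x) - real m * \<mu>\<bar> \<ge> real m * d} \<inter> set_pmf (replicate_pmf m p)"
    by (auto simp: set_replicate_pmf g_def sum_list_subtractf sum_list_triv)
  then have "measure_pmf.prob (replicate_pmf m p) {xs. \<bar>\<Sum>x\<leftarrow>xs. g x\<bar> \<ge> real m * d}
    = measure_pmf.prob (replicate_pmf m p) {xs. \<bar>(\<Sum>x\<leftarrow>xs. f x) - real m * \<mu>\<bar> \<ge> real m * d}"
    by (metis measure_Int_set_pmf)
  finally show ?thesis .
qed


section \<open>Length and size bounds for decks of traces\<close>

lemma length_of_mem_deck: "w \<in># deck k x \<Longrightarrow> length w = k"
proof -
  assume "w \<in># deck k x"
  then obtain S where S: "S \<subseteq> {..<length x}" "card S = k" "w = nths x S"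
    unfolding deck_def by (auto simp: finite_set_mset_mset_set)
  then have "{i. i < length x \<and> i \<in> S} = S"
    by auto
  with S show ?thesis
    by (simp add: length_nths)
qed

lemma size_deck_le: "length t \<le> n \<Longrightarrow> size (filter_mset P (deck k t)) \<le> n ^ k"
proof -
  assume "length t \<le> n"
  have "size (filter_mset P (deck k t)) \<le> length t choose k"
    by (metis size_deck size_filter_mset_lesseq)
  also have "\<dots> \<le> length t ^ k"
    by (cases "k \<le> length t") (simp_all add: binomial_le_pow binomial_eq_0)
  also have "\<dots> \<le> n ^ k"
    using \<open>length t \<le> n\<close> by (rule power_mono) simp
  finally show ?thesis .
qed

lemma length_deletion_channel: "t \<in> set_pmf (deletion_channel p x) \<Longrightarrow> length t \<le> length x"
proof -
  assume "t \<in> set_pmf (deletion_channel p x)"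
  then obtain A where A: "t = nths x A"
    unfolding deletion_channel_def by auto
  have "card {i. i < length x \<and> i \<in> A} \<le> card {..<length x}"
    by (intro card_mono) auto
  then show ?thesis
    by (simp add: A length_nths)
qed

section \<open>The estimator and its correctness on good samples\<close>

definition deck_mass :: "nat \<Rightarrow> ('a list \<Rightarrow> bool) \<Rightarrow> 'a list list \<Rightarrow> real" where
  "deck_mass k P ts = (\<Sum>t\<leftarrow>ts. real (size (filter_mset P (deck k t))))"

definition deck_estimate :: "nat \<Rightarrow> nat \<Rightarrow> 'a list list \<Rightarrow> 'a list multiset" where
  "deck_estimate n k ts = (THE M. \<forall>w.
     \<bar>deck_mass k (\<lambda>_. True) ts * real (count M w) - real (n choose k) * deck_mass k (\<lambda>v. v = w) ts\<bar>
       < deck_mass k (\<lambda>_. True) ts / 2)"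

text \<open>Rounding is expressed by uniqueness of \<open>M\<close>. The strict inequality forces \<open>N > 0\<close>, so at most
  one \<open>M\<close> qualifies; if none does, \<open>THE\<close> returns an arbitrary value.\<close>
lemma deck_estimate_eqI:
  assumes "\<And>w. \<bar>deck_mass k (\<lambda>_. True) ts * real (count M w) - real (n choose k) * deck_mass k (\<lambda>v. v = w) ts\<bar>
       < deck_mass k (\<lambda>_. True) ts / 2"
  shows "deck_estimate n k ts = M"
  unfolding deck_estimate_def
proof (rule the_equality)
  let ?N = "deck_mass k (\<lambda>_. True) ts"
  show "\<forall>w. \<bar>?N * real (count M w) - real (n choose k) * deck_mass k (\<lambda>v. v = w) ts\<bar> < ?N / 2"
    using assms by blast
  fix M' assume M': "\<forall>w. \<bar>?N * real (count M' w) - real (n choose k) * deck_mass k (\<lambda>v. v = w) ts\<bar> < ?N / 2"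
  have pos: "?N > 0"
    using assms[of "[]"] by linarith
  have "count M' w = count M w" for w
  proof -
    have "\<bar>?N * real (count M' w) - ?N * real (count M w)\<bar> < ?N"
      using assms[of w] M'[rule_format, of w] by linarith
    then have "?N * \<bar>real (count M' w) - real (count M w)\<bar> < ?N"
      using pos by (simp add: abs_mult flip: right_diff_distrib)
    then have "\<bar>real (count M' w) - real (count M w)\<bar> < 1"
      using pos by simp
    then show ?thesis
      by linarith
  qed
  then show "M' = M"
    by (simp add: multiset_eq_iff)
qed

text \<open>This is the deterministic half of the argument; \<open>a\<close> stands for the expected
  number of traces in which a fixed \<open>k\<close>-subset of positions survives.\<close>

lemma deck_estimate_eq_deck:
  fixes a :: real
  assumes len: "length x = n" "k \<le> n" and a: "a > 0"
    and total: "\<bar>deck_mass k (\<lambda>_. True) ts - a * real (n choose k)\<bar> < a / 8"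
    and each: "\<And>w. length w = k \<Longrightarrow>
      \<bar>deck_mass k (\<lambda>v. v = w) ts - a * real (count (deck k x) w)\<bar> < a / 8"
  shows "deck_estimate n k ts = deck k x"
proof (rule deck_estimate_eqI)
  fix w
  define N where "N = deck_mass k (\<lambda>_. True) ts"
  define S where "S = deck_mass k (\<lambda>v. v = w) ts"
  define b where "b = real (n choose k)"
  define c where "c = real (count (deck k x) w)"
  have b: "b \<ge> 1"
    using len(2) by (simp add: b_def Suc_leI)
  have c: "0 \<le> c" "c \<le> b"
    using count_le_size[of "deck k x" w] len(1) by (simp_all add: c_def b_def size_deck)
  have S: "\<bar>S - a * c\<bar> < a / 8"
  \<comment> \<open>Words of another length occur in no \<open>k\<close>-deck, so both counts
    vanish. Hence finitely many words suffice in the union bound.\<close>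
  proof (cases "length w = k")
    case False
    then have "count (deck k t) w = 0" for t
      using length_of_mem_deck by (auto simp: count_eq_zero_iff)
    then show ?thesis
      using a by (simp add: S_def c_def deck_mass_def filter_eq_replicate_mset sum_list_triv)
  qed (use each in \<open>simp add: S_def c_def\<close>)
  have N: "\<bar>N - a * b\<bar> < a / 8"
    using total by (simp add: N_def b_def)
  have ab: "a \<le> a * b"
    using a b by simp
  \<comment> \<open>The main terms \<open>a * b * c\<close> cancel, so only the two deviations
    remain and \<open>a\<close> need not be known.\<close>
  have "N * c - b * S = c * (N - a * b) - b * (S - a * c)"
    by (simp add: algebra_simps)
  then have "\<bar>N * c - b * S\<bar> \<le> c * \<bar>N - a * b\<bar> + b * \<bar>S - a * c\<bar>"
    using b c by (metis abs_mult abs_of_nonneg abs_triangle_ineq4 order_trans zero_le_one)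
  \<comment> \<open>The tolerance 1/8 gives an error of at most \<open>a * b / 4\<close>, while
    \<open>N\<close> exceeds \<open>7 * a * b / 8\<close> because \<open>b \<ge> 1\<close>; so the
    error is below \<open>N / 2\<close>.\<close>
  also have "\<dots> \<le> b * (a / 8) + b * (a / 8)"
    using N S b c a by (intro add_mono mult_mono) auto
  also have "\<dots> = a * b / 4"
    by simp
  also have "\<dots> < N / 2"
  proof -
    have "a * b - a / 8 < N"
      using N by linarith
    then show ?thesis
      using ab a by linarith
  qed
  finally show "\<bar>N * c - b * S\<bar> < N / 2" .
qed

section \<open>Failure probability\<close>

lemma deck_mass_deviation:
  assumes p: "0 \<le> p" "p \<le> 1 - real k / real n" and k: "k \<ge> 1" and n: "n \<ge> 1" and len: "length x = n"
  shows "measure_pmf.prob (traces (n ^ (6 * k)) p x)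
      {ts. \<bar>deck_mass k P ts - real (n ^ (6 * k)) * (1 - p) ^ k * real (size (filter_mset P (deck k x)))\<bar>
        \<ge> real (n ^ (6 * k)) * (1 - p) ^ k / 8} \<le> 64 / real n ^ (2 * k)"
proof -
  define q where "q = 1 - p"
  define r where "r = real n ^ k"
  have r: "r > 0"
    using n by (simp add: r_def)
  have "1 / real n \<le> real k / real n"
    using k by (intro divide_right_mono) auto
  then have "1 / real n \<le> q"
    using p by (simp add: q_def)
  then have "(1 / real n) ^ k \<le> q ^ k"
    by (intro power_mono) auto
  then have rq: "1 / r \<le> q ^ k"
    by (simp add: r_def power_one_over)
  have q: "q > 0"
    using \<open>1 / real n \<le> q\<close> n by (intro less_le_trans[of 0 "1 / real n" q]) auto
  have p1: "p \<le> 1"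
    using p(2) by (smt (verit) divide_nonneg_nonneg of_nat_0_le_iff)
  have m: "real (n ^ (6 * k)) = r ^ 6"
    by (simp add: r_def power_mult mult.commute[of 6 k])
  have "measure_pmf.prob (traces (n ^ (6 * k)) p x)
      {ts. \<bar>deck_mass k P ts - real (n ^ (6 * k)) * (q ^ k * real (size (filter_mset P (deck k x))))\<bar>
        \<ge> real (n ^ (6 * k)) * (q ^ k / 8)} \<le> r\<^sup>2 / (real (n ^ (6 * k)) * (q ^ k / 8)\<^sup>2)"
    unfolding traces_def deck_mass_def q_def expectation_filter_deck[OF p(1) p1, symmetric]
  proof (rule replicate_pmf_deviation[OF finite_deletion_channel])
    show "0 < n ^ (6 * k)"
      using n by simp
    show "0 < (1 - p) ^ k / 8"
      using q by (simp add: q_def)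
    fix t assume "t \<in> set_pmf (deletion_channel p x)"
    then have "size (filter_mset P (deck k t)) \<le> n ^ k"
      using length_deletion_channel len by (blast intro: size_deck_le)
    then have "real (size (filter_mset P (deck k t))) \<le> real (n ^ k)"
      by (simp only: of_nat_le_iff)
    then show "\<bar>real (size (filter_mset P (deck k t)))\<bar> \<le> r"
      by (simp add: r_def)
  qed
  \<comment> \<open>With \<open>r ^ 6\<close> traces and \<open>q ^ k \<ge> 1 / r\<close> the bound
    becomes \<open>64 / r\<^sup>2\<close>: one factor \<open>1 / r\<close> will pay for the union
    bound, the other makes the error vanish.\<close>
  also have "\<dots> = 64 / (r ^ 4 * (q ^ k)\<^sup>2)"
  proof -
    have "r\<^sup>2 / (r ^ 6 * (s / 8)\<^sup>2) = 64 / (r ^ 4 * s\<^sup>2)" for s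
      using r by (simp add: power_divide eval_nat_numeral)
    then show ?thesis
      unfolding m .
  qed
  also have "\<dots> \<le> 64 / (r ^ 4 * (1 / r)\<^sup>2)"
    using r rq q by (intro divide_left_mono mult_left_mono power_mono mult_pos_pos) auto
  also have "\<dots> = 64 / r\<^sup>2"
    using r by (simp add: power_divide eval_nat_numeral)
  also have "r\<^sup>2 = real n ^ (2 * k)"
    by (simp add: r_def power_mult mult.commute[of 2 k])
  finally show ?thesis
    by (simp add: q_def mult.assoc)
qed

lemma prob_deck_estimate:
  fixes x :: "bool list"
  assumes p: "0 \<le> p" "p \<le> 1 - real k / real n" and k: "k \<ge> 1" and n: "n \<ge> 2" and len: "length x = n"
  shows "measure_pmf.prob (traces (n ^ (6 * k)) p x) {ts. deck_estimate n k ts = deck k x} \<ge> 1 - 128 / real n"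
proof -
  let ?M = "traces (n ^ (6 * k)) p x"
  define a where "a = real (n ^ (6 * k)) * (1 - p) ^ k"
  define bad where "bad P = {ts. \<bar>deck_mass k P ts - a * real (size (filter_mset P (deck k x)))\<bar> \<ge> a / 8}"
    for P :: "bool list \<Rightarrow> bool"
  define I where "I = insert (\<lambda>_. True) ((\<lambda>w v. v = w) ` {w :: bool list. length w = k})"
  have lists: "finite {w :: bool list. length w = k}" "card {w :: bool list. length w = k} = 2 ^ k"
    using finite_lists_length_eq[of "UNIV :: bool set" k] card_lists_length_eq[of "UNIV :: bool set" k] by simp_all
  have finI: "finite I"
    using lists by (simp add: I_def)
  have "card I \<le> Suc (2 ^ k)"
    unfolding I_def using card_image_le[OF lists(1), of "\<lambda>w v. v = w"] lists
    by (intro order_trans[OF card_insert_le_m1]) auto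
  also have "\<dots> \<le> 2 * 2 ^ k"
    by (simp add: Suc_leI)
  \<comment> \<open>This is where \<open>n \<ge> 2\<close> enters: the number of events is compared
    with a power of \<open>n\<close>.\<close>
  also have "\<dots> \<le> 2 * n ^ k"
    using n by (simp add: power_mono)
  finally have "real (card I) \<le> real (2 * n ^ k)"
    by (simp only: of_nat_le_iff)
  then have cardI: "real (card I) \<le> 2 * real n ^ k"
    by simp
  have kn: "real k / real n \<le> 1"
    using p by linarith
  then have "k \<le> n"
    using n by (simp add: divide_le_eq)
  \<comment> \<open>Together with the bound on \<open>p\<close> this excludes \<open>p = 1\<close>,
    where no coordinate survives and \<open>a\<close> would be 0.\<close>
  have "0 < real k / real n"
    using k n by simp
  then have "a > 0"
    using p n by (auto simp: a_def)
  have "measure_pmf.prob ?M (\<Union>(bad ` I)) \<le> (\<Sum>P\<in>I. measure_pmf.prob ?M (bad P))"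
    using finI by (intro measure_pmf.finite_measure_subadditive_finite) auto
  also have "\<dots> \<le> (\<Sum>P\<in>I. 64 / real n ^ (2 * k))"
    unfolding bad_def a_def using deck_mass_deviation[OF p k _ len] n by (intro sum_mono) auto
  also have "\<dots> \<le> 2 * real n ^ k * (64 / real n ^ (2 * k))"
    using cardI by (simp only: sum_constant) (intro mult_right_mono, auto)
  also have "\<dots> = 128 / real n ^ k"
  proof -
    have "real n ^ (2 * k) = real n ^ k * real n ^ k"
      by (simp only: mult_2 power_add)
    then show ?thesis
      using n by simp
  qed
  \<comment> \<open>The error must be uniform in \<open>k\<close>, so \<open>k \<ge> 1\<close> is
    used to drop the exponent.\<close>
  also have "\<dots> \<le> 128 / real n"
    using k n self_le_power[of "real n" k] by (intro divide_left_mono) auto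
  finally have "1 - 128 / real n \<le> measure_pmf.prob ?M (- \<Union>(bad ` I))"
    using measure_pmf.prob_compl[of "\<Union>(bad ` I)" ?M] by (simp add: Compl_eq_Diff_UNIV)
  also have "\<dots> \<le> measure_pmf.prob ?M {ts. deck_estimate n k ts = deck k x}"
  proof (rule measure_pmf.finite_measure_mono)
    show "- \<Union>(bad ` I) \<subseteq> {ts. deck_estimate n k ts = deck k x}"
    proof
      fix ts assume "ts \<in> - \<Union>(bad ` I)"
      then have good: "\<bar>deck_mass k P ts - a * real (size (filter_mset P (deck k x)))\<bar> < a / 8" if "P \<in> I" for P
        using that by (auto simp: bad_def not_le)
      have "deck_estimate n k ts = deck k x"
      proof (rule deck_estimate_eq_deck[OF len \<open>k \<le> n\<close> \<open>a > 0\<close>])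
        show "\<bar>deck_mass k (\<lambda>_. True) ts - a * real (n choose k)\<bar> < a / 8"
          using good[of "\<lambda>_. True"] by (simp add: I_def size_deck len)
        show "\<bar>deck_mass k (\<lambda>v. v = w) ts - a * real (count (deck k x) w)\<bar> < a / 8" if "length w = k" for w
          using good[of "\<lambda>v. v = w"] that by (auto simp: I_def filter_eq_replicate_mset)
      qed
      then show "ts \<in> {ts. deck_estimate n k ts = deck k x}"
        by simp
    qed
  qed simp
  finally show ?thesis .
qed

theorem theorem12:
  "\<exists>(C :: real) (m :: nat \<Rightarrow> nat \<Rightarrow> nat)
     (reconstruct :: nat \<Rightarrow> nat \<Rightarrow> bool list list \<Rightarrow> bool list multiset)
     (err :: nat \<Rightarrow> real).
     C > 0 \<and>
     (\<forall>n\<ge>1. \<forall>k. real (m n k) \<le> exp (C * (real k * ln (real n)))) \<and>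
     err \<longlonglongrightarrow> 0 \<and>
     (\<forall>n\<ge>1. \<forall>(k :: nat) (p :: real) (x :: bool list).
        length x = n \<longrightarrow> 0 \<le> p \<longrightarrow> p \<le> 1 - real k / real n \<longrightarrow>
        measure_pmf.prob (traces (m n k) p x) {ts. reconstruct n k ts = deck k x} \<ge> 1 - err n)"
proof (intro exI conjI allI impI)
  show "(6 :: real) > 0"
    by simp
  show "real (n ^ (6 * k)) \<le> exp (6 * (real k * ln (real n)))" if "n \<ge> 1" for n k :: nat
  proof -
    have "exp (6 * (real k * ln (real n))) = exp (real (6 * k) * ln (real n))"
      by simp
    also have "\<dots> = exp (ln (real n)) ^ (6 * k)"
      by (rule exp_of_nat_mult)
    finally show ?thesis
      using that by simp
  qed
  show "(\<lambda>n. 128 / real n) \<longlonglongrightarrow> 0"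
    by (rule lim_const_over_n)
  fix n k :: nat and p :: real and x :: "bool list"
  assume *: "n \<ge> 1" "length x = n" "0 \<le> p" "p \<le> 1 - real k / real n"
  let ?rec = "\<lambda>n k ts. if k = 0 then {#[]#} else deck_estimate n k ts"
  show "1 - 128 / real n \<le> measure_pmf.prob (traces (n ^ (6 * k)) p x) {ts. ?rec n k ts = deck k x}"
  \<comment> \<open>These cases lie outside \<open>prob_deck_estimate\<close>. For
    \<open>k = 0\<close> the deck is the same for every \<open>x\<close> and \<open>?rec\<close>
    returns it outright; for \<open>n = 1\<close> the claimed lower bound is negative.\<close>
  proof (cases "k = 0 \<or> n = 1")
    case True
    then show ?thesis
    proof
      assume "n = 1"
      then have "1 - 128 / real n \<le> 0"
        by simp
      then show ?thesis
        using measure_nonneg order_trans by blast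
    qed (simp add: deck_0)
  next
    case False
    then show ?thesis
      using * prob_deck_estimate[of p k n x] by simp
  qed
qed

end
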